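(* There exist a domain $D\subset\mathbb{C}$ and a constant $C>0$ such that the family $\mathcal{F}_{1,C}(D)$ of all meromorphic functions $f$ in $D$ satisfying $$\frac{|f'(z)|}{1+|f(z)|}>C\quad\text{for every } z\in D$$ is quasi-normal of infinite order in $D$; that is, $\mathcal{F}_{1,C}(D)$ is quasi-normal in $D$, but for no $\nu\in\mathbb{N}$ is it quasi-normal of order at most $\nu$ in $D$.
   Context: A domain is a nonempty connected open subset of $\mathbb{C}$. Meromorphic functions on $D$ are regarded as maps into the Riemann sphere $\hat{\mathbb{C}}$ with the spherical (chordal) metric $\chi$. At a pole $z_0$ of $f$, the value of $|f'(z)|/(1+|f(z)|)$ is understood as its limit in $[0,+\infty]$ as $z\to z_0$. A family $\mathcal{F}$ of functions meromorphic in $D$ is quasi-normal in $D$ if every sequence in $\mathcal{F}$ has a subsequence for which there is a set $E\subset D$ with no accumulation points in $D$ such that the subsequence converges with respect to $\chi$ uniformly on compact subsets of $D\setminus E$. The set $E$ may depend on the subsequence. For $\nu\in\mathbb{N}$, the family is quasi-normal of order at most $\nu$ if, in addition, the subsequence and $E$ can always be chosen with $|E|\le\nu$. *)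

theory Defs
  imports "HOL-Complex_Analysis.Complex_Analysis"
begin

section \<open>The Riemann sphere with the chordal metric\<close>

datatype riemann_sphere = Fin complex | Infty

text \<open>
  The chordal metric is normalised so that the sphere has diameter 1. The other common
  normalisation (twice this one) yields the same uniform convergence.
\<close>

fun chordal :: "riemann_sphere \<Rightarrow> riemann_sphere \<Rightarrow> real" where
  "chordal (Fin z) (Fin w) = cmod (z - w) / (sqrt (1 + (cmod z)\<^sup>2) * sqrt (1 + (cmod w)\<^sup>2))"
| "chordal (Fin z) Infty = 1 / sqrt (1 + (cmod z)\<^sup>2)"
| "chordal Infty (Fin w) = 1 / sqrt (1 + (cmod w)\<^sup>2)"
| "chordal Infty Infty = 0"

text \<open>
  Inverse stereographic projection onto the sphere of diameter 1 resting on the plane;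
  it serves only to prove the triangle inequality.
\<close>

fun stereo :: "riemann_sphere \<Rightarrow> complex \<times> real" where
  "stereo (Fin z) = (z / of_real (1 + (cmod z)\<^sup>2), (cmod z)\<^sup>2 / (1 + (cmod z)\<^sup>2))"
| "stereo Infty = (0, 1)"

lemma stereo_dist_Fin:
  "dist (stereo (Fin z)) (stereo (Fin w)) = chordal (Fin z) (Fin w)"
proof -
  define a b where "a = 1 + (cmod z)\<^sup>2" and "b = 1 + (cmod w)\<^sup>2"
  have pos: "a > 0" "b > 0"
    unfolding a_def b_def by (simp_all add: add_pos_nonneg)
  define x y u v where "x = Re z" and "y = Im z" and "u = Re w" and "v = Im w"
  have a: "a = 1 + x\<^sup>2 + y\<^sup>2" and b: "b = 1 + u\<^sup>2 + v\<^sup>2"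
    by (simp_all add: a_def b_def x_def y_def u_def v_def cmod_power2)
  have "(dist (stereo (Fin z)) (stereo (Fin w)))\<^sup>2
      = (x/a - u/b)\<^sup>2 + (y/a - v/b)\<^sup>2 + ((a - 1)/a - (b - 1)/b)\<^sup>2"
    by (simp add: dist_prod_def dist_norm cmod_power2 x_def y_def u_def v_def a_def b_def
          del: of_real_add of_real_power)
  also have "\<dots> = ((x * b - u * a)\<^sup>2 + (y * b - v * a)\<^sup>2 + (a - b)\<^sup>2) / (a\<^sup>2 * b\<^sup>2)"
  proof -
    have "x/a - u/b = (x * b - u * a)/(a*b)" "y/a - v/b = (y * b - v * a)/(a*b)"
         "(a - 1)/a - (b - 1)/b = (a - b)/(a*b)"
      using pos by (simp_all add: field_simps)
    then show ?thesis
      by (simp only: power_divide power_mult_distrib add_divide_distrib)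
  qed
  also have "(x * b - u * a)\<^sup>2 + (y * b - v * a)\<^sup>2 + (a - b)\<^sup>2 = ((x - u)\<^sup>2 + (y - v)\<^sup>2) * (a * b)"
    unfolding a b by algebra
  also have "((x - u)\<^sup>2 + (y - v)\<^sup>2) * (a * b) / (a\<^sup>2 * b\<^sup>2) = ((x - u)\<^sup>2 + (y - v)\<^sup>2) / (a * b)"
    using pos by (simp add: power2_eq_square)
  also have "\<dots> = (chordal (Fin z) (Fin w))\<^sup>2"
    using pos by (simp add: power_divide power_mult_distrib flip: a_def b_def)
      (simp add: cmod_power2 x_def y_def u_def v_def)
  finally have "(dist (stereo (Fin z)) (stereo (Fin w)))\<^sup>2 = (chordal (Fin z) (Fin w))\<^sup>2" .
  then show ?thesis
    by (rule power2_eq_imp_eq) simp_all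
qed

lemma stereo_dist_Fin_Infty:
  "dist (stereo (Fin z)) (stereo Infty) = chordal (Fin z) Infty"
proof -
  define a where "a = 1 + (cmod z)\<^sup>2"
  have pos: "a > 0"
    unfolding a_def by (simp add: add_pos_nonneg)
  have "(dist (stereo (Fin z)) (stereo Infty))\<^sup>2 = (cmod z / a)\<^sup>2 + ((a - 1) / a - 1)\<^sup>2"
    using pos by (simp add: dist_prod_def dist_norm norm_divide a_def power2_commute[of 1] del: of_real_add of_real_power)
  also have "\<dots> = (a - 1) / a\<^sup>2 + 1 / a\<^sup>2"
  proof -
    have "(a - 1) / a - 1 = - (1 / a)"
      using pos by (simp add: field_simps)
    then have "((a - 1) / a - 1)\<^sup>2 = 1 / a\<^sup>2"
      by (simp add: power_divide)
    then show ?thesis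
      by (simp add: power_divide) (simp add: a_def)
  qed
  also have "\<dots> = 1 / a"
    using pos by (simp add: power2_eq_square flip: add_divide_distrib)
  also have "\<dots> = (chordal (Fin z) Infty)\<^sup>2"
    using pos by (simp add: power_divide flip: a_def)
  finally have "(dist (stereo (Fin z)) (stereo Infty))\<^sup>2 = (chordal (Fin z) Infty)\<^sup>2" .
  then show ?thesis
    by (rule power2_eq_imp_eq) simp_all
qed

lemma chordal_eq_stereo_dist: "chordal p q = dist (stereo p) (stereo q)"
proof (cases p; cases q)
  fix w assume "p = Infty" "q = Fin w"
  then show ?thesis
    using stereo_dist_Fin_Infty[of w] by (simp add: dist_commute del: stereo.simps)
qed (simp_all add: stereo_dist_Fin stereo_dist_Fin_Infty del: stereo.simps chordal.simps(1,2))

lemma sqrt_one_plus_square_pos: "sqrt (1 + (cmod z)\<^sup>2) > 0"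
  by (simp add: add_pos_nonneg)

lemma chordal_eq_0_iff: "chordal p q = 0 \<longleftrightarrow> p = q"
  using sqrt_one_plus_square_pos by (cases p; cases q) (auto simp: less_le)

instantiation riemann_sphere :: metric_space
begin

definition dist_riemann_sphere_def: "dist p q = chordal p q"

definition uniformity_riemann_sphere_def:
  "(uniformity :: (riemann_sphere \<times> riemann_sphere) filter) =
     (INF e\<in>{0<..}. principal {(p, q). dist p q < e})"

definition open_riemann_sphere_def:
  "open (U :: riemann_sphere set) \<longleftrightarrow>
     (\<forall>p\<in>U. eventually (\<lambda>(p', q). p' = p \<longrightarrow> q \<in> U) uniformity)"

instance
proof
  fix p q r :: riemann_sphere
  show "dist p q = 0 \<longleftrightarrow> p = q"
    by (simp add: dist_riemann_sphere_def chordal_eq_0_iff)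
  show "dist p q \<le> dist p r + dist q r"
    unfolding dist_riemann_sphere_def chordal_eq_stereo_dist by (rule dist_triangle2)
qed (simp_all add: uniformity_riemann_sphere_def open_riemann_sphere_def)

end


section \<open>Meromorphic functions and quasi-normal families\<close>

definition complex_domain :: "complex set \<Rightarrow> bool" where
  "complex_domain D \<longleftrightarrow> D \<noteq> {} \<and> open D \<and> connected D"

text \<open>
  Meromorphic functions in \<open>D\<close> are represented by functions that are
  \<^const>\<open>nicely_meromorphic_on\<close> \<open>D\<close>: removable singularities are removed, and the value at
  a pole is the dummy 0, which the following map replaces by the point at infinity.
  Values outside \<open>D\<close> play no role.
\<close>

definition sphere_val :: "(complex \<Rightarrow> complex) \<Rightarrow> complex \<Rightarrow> riemann_sphere" where
  "sphere_val f z = (if is_pole f z then Infty else Fin (f z))"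

definition deriv_quotient :: "(complex \<Rightarrow> complex) \<Rightarrow> complex \<Rightarrow> ennreal" where
  "deriv_quotient f z =
     (if is_pole f z
      then Lim (at z) (\<lambda>w. ennreal (cmod (deriv f w) / (1 + cmod (f w))))
      else ennreal (cmod (deriv f z) / (1 + cmod (f z))))"

definition family_F1 :: "real \<Rightarrow> complex set \<Rightarrow> (complex \<Rightarrow> complex) set" where
  "family_F1 C D = {f. f nicely_meromorphic_on D \<and> (\<forall>z\<in>D. deriv_quotient f z > ennreal C)}"

text \<open>Locally uniform convergence in \<open>U\<close> with respect to the chordal metric.\<close>

definition chordal_convergent_on ::
  "(nat \<Rightarrow> complex \<Rightarrow> complex) \<Rightarrow> complex set \<Rightarrow> bool" where
  "chordal_convergent_on f U \<longleftrightarrow>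
     (\<exists>g. \<forall>K. compact K \<and> K \<subseteq> U \<longrightarrow> uniform_limit K (\<lambda>n. sphere_val (f n)) g sequentially)"

definition quasi_normal :: "(complex \<Rightarrow> complex) set \<Rightarrow> complex set \<Rightarrow> bool" where
  "quasi_normal F D \<longleftrightarrow>
     (\<forall>f. range f \<subseteq> F \<longrightarrow>
       (\<exists>r E. strict_mono (r :: nat \<Rightarrow> nat) \<and> E \<subseteq> D \<and> (\<forall>z\<in>D. \<not> z islimpt E) \<and>
              chordal_convergent_on (f \<circ> r) (D - E)))"

definition quasi_normal_order_le ::
  "nat \<Rightarrow> (complex \<Rightarrow> complex) set \<Rightarrow> complex set \<Rightarrow> bool" where
  "quasi_normal_order_le \<nu> F D \<longleftrightarrow>
     (\<forall>f. range f \<subseteq> F \<longrightarrow>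
       (\<exists>r E. strict_mono (r :: nat \<Rightarrow> nat) \<and> E \<subseteq> D \<and> (\<forall>z\<in>D. \<not> z islimpt E) \<and>
              finite E \<and> card E \<le> \<nu> \<and> chordal_convergent_on (f \<circ> r) (D - E)))"

definition quasi_normal_infinite_order :: "(complex \<Rightarrow> complex) set \<Rightarrow> complex set \<Rightarrow> bool" where
  "quasi_normal_infinite_order F D \<longleftrightarrow>
     quasi_normal F D \<and> (\<forall>\<nu>. \<not> quasi_normal_order_le \<nu> F D)"

end

theory Submission
  imports Defs
begin

text \<open>
  Up to constants, the inequality \<open>\<bar>f'\<bar> > C (1 + \<bar>f\<bar>)\<close> says that the two functions \<open>1 / f'\<close> and
  \<open>f / f'\<close> are bounded. Both vanish at the poles of \<open>f\<close>, so they extend holomorphically to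
  \<open>D\<close>, and Montel's theorem provides, for every sequence \<open>f\<^sub>n\<close> in the family, a subsequence
  along which \<open>u\<^sub>n = 1 / f\<^sub>n'\<close> and \<open>v\<^sub>n = f\<^sub>n / f\<^sub>n'\<close> converge locally uniformly to
  holomorphic functions \<open>u\<close> and \<open>v\<close>. Since \<open>f\<^sub>n = v\<^sub>n / u\<^sub>n\<close>, the subsequence tends to
  \<open>v / u\<close> off the zeros of \<open>u\<close> if \<open>u\<close> is not identically zero, and to infinity off the zeros
  of \<open>v\<close> if \<open>u\<close> vanishes identically and \<open>v\<close> does not.

  There remains the case \<open>u = v = 0\<close>, where the convergence to infinity is locally uniform on
  all of \<open>D\<close> (\<open>large_if_newton_step_small\<close>). At a zero of \<open>f\<^sub>n\<close> the derivative of \<open>v\<^sub>n\<close> is 1,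
  whereas \<open>v\<^sub>n'\<close> tends to 0; hence \<open>f\<^sub>n\<close> eventually has no zeros on a given compact set and
  \<open>g = 1 / f\<^sub>n\<close> is holomorphic there. It satisfies \<open>\<bar>g\<bar>\<^sup>2 = \<bar>u\<^sub>n\<bar> \<bar>g'\<bar>\<close>, and a holomorphic
  function on a disc whose square is dominated by a small multiple of its derivative is itself
  small (\<open>bound_of_square_le_deriv\<close>). Thus the family is quasi-normal on every domain and for
  every \<open>C > 0\<close>.

  The order is infinite for the half-plane \<open>Re z > -1\<close>, because the functions
  \<open>n (exp z - 1)\<close> lie in the family with \<open>C = 1 / 8\<close>: both \<open>1\<close> and \<open>\<bar>exp z - 1\<bar>\<close> are there
  at most a constant times \<open>\<bar>exp z\<bar>\<close>. They tend to infinity except at the infinitely many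
  points \<open>2 k \<pi> i\<close>, where they vanish, and no subsequence converges uniformly near any of
  these points.
\<close>

section \<open>The reciprocal derivative and the Newton step\<close>

definition recip_deriv :: "(complex \<Rightarrow> complex) \<Rightarrow> complex \<Rightarrow> complex" where
  "recip_deriv f z = (if is_pole f z then 0 else 1 / deriv f z)"

text \<open>
  The correction applied to \<open>z\<close> by Newton's method for the equation \<open>f z = 0\<close>.
\<close>

definition newton_step :: "(complex \<Rightarrow> complex) \<Rightarrow> complex \<Rightarrow> complex" where
  "newton_step f z = f z * recip_deriv f z"

lemma family_F1_bound:
  assumes "f \<in> family_F1 C D" "C > 0" "z \<in> D" "\<not> is_pole f z"
  shows "C * (1 + cmod (f z)) < cmod (deriv f z)"
proof -
  have "ennreal C < ennreal (cmod (deriv f z) / (1 + cmod (f z)))"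
    using assms by (auto simp: family_F1_def deriv_quotient_def)
  then have "C < cmod (deriv f z) / (1 + cmod (f z))"
    using \<open>C > 0\<close> by (simp add: ennreal_less_iff)
  moreover have "1 + cmod (f z) > 0"
    by (simp add: add_pos_nonneg)
  ultimately show ?thesis
    by (simp add: pos_less_divide_eq)
qed

lemma family_F1_deriv_nonzero:
  assumes "f \<in> family_F1 C D" "C > 0" "z \<in> D" "\<not> is_pole f z"
  shows "deriv f z \<noteq> 0"
proof
  assume "deriv f z = 0"
  with family_F1_bound[OF assms] have "C * (1 + cmod (f z)) < 0"
    by simp
  moreover have "C * (1 + cmod (f z)) \<ge> 0"
    using \<open>C > 0\<close> by simp
  ultimately show False
    by simp
qed

lemma family_F1_value_at_pole:
  assumes "f \<in> family_F1 C D" "z \<in> D" "is_pole f z"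
  shows "f z = 0"
  using assms is_pole_zero_at_nicely_mero by (auto simp: family_F1_def)

lemma family_F1_analytic:
  assumes "f \<in> family_F1 C D" "z \<in> D" "\<not> is_pole f z"
  shows "f analytic_on {z}"
  using assms nicely_meromorphic_on_imp_analytic_at by (auto simp: family_F1_def)

lemma family_F1_isolated_singularity:
  assumes "f \<in> family_F1 C D" "z \<in> D"
  shows "isolated_singularity_at f z"
proof -
  have "f meromorphic_on {z}"
    using assms meromorphic_on_subset[of f D "{z}"]
    by (auto simp: family_F1_def nicely_meromorphic_on_def)
  then show ?thesis
    by (rule meromorphic_on_isolated_singularity)
qed

lemma recip_deriv_eq_0_iff:
  assumes "f \<in> family_F1 C D" "C > 0" "z \<in> D"
  shows "recip_deriv f z = 0 \<longleftrightarrow> is_pole f z"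
  using family_F1_deriv_nonzero[OF assms] by (simp add: recip_deriv_def)

lemma norm_recip_deriv_le:
  assumes "f \<in> family_F1 C D" "C > 0" "z \<in> D"
  shows "cmod (recip_deriv f z) \<le> 1 / C"
proof (cases "is_pole f z")
  case False
  have "C * 1 \<le> C * (1 + cmod (f z))"
    using \<open>C > 0\<close> by (intro mult_left_mono) auto
  with family_F1_bound[OF assms False] have "C \<le> cmod (deriv f z)"
    by simp
  with False \<open>C > 0\<close> show ?thesis
    by (simp add: recip_deriv_def norm_divide frac_le)
qed (use \<open>C > 0\<close> in \<open>simp add: recip_deriv_def\<close>)

lemma norm_newton_step_le:
  assumes "f \<in> family_F1 C D" "C > 0" "z \<in> D"
  shows "cmod (newton_step f z) \<le> 1 / C"
proof (cases "is_pole f z")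
  case False
  have "C * cmod (f z) \<le> C * (1 + cmod (f z))"
    using \<open>C > 0\<close> by (intro mult_left_mono) auto
  with family_F1_bound[OF assms False] have "C * cmod (f z) \<le> cmod (deriv f z)"
    by simp
  moreover have "cmod (deriv f z) > 0"
    using family_F1_deriv_nonzero[OF assms False] by simp
  ultimately show ?thesis
    using False \<open>C > 0\<close> by (simp add: newton_step_def recip_deriv_def norm_divide field_simps)
qed (use \<open>C > 0\<close> in \<open>simp add: newton_step_def recip_deriv_def\<close>)

lemma eventually_not_is_pole:
  assumes "isolated_singularity_at f (z :: complex)"
  shows "eventually (\<lambda>w. \<not> is_pole f w) (at z)"
proof -
  from assms obtain r where r: "r > 0" "f analytic_on ball z r - {z}"
    by (auto simp: isolated_singularity_at_def)
  have "eventually (\<lambda>w. w \<in> ball z r - {z}) (at z)"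
    using r(1) eventually_at_in_open[of "ball z r" z] by simp
  then show ?thesis
  proof (rule eventually_mono)
    fix w assume "w \<in> ball z r - {z}"
    with r(2) have "f analytic_on {w}"
      using analytic_on_subset[of f "ball z r - {z}" "{w}"] by simp
    then show "\<not> is_pole f w"
      by (rule analytic_at_imp_no_pole)
  qed
qed

text \<open>
  The derivative has a pole wherever \<open>f\<close> has one, so the value 0 given to the reciprocal at a
  pole is the one that removes the singularity.
\<close>

lemma recip_deriv_analytic:
  assumes f: "f \<in> family_F1 C D" "C > 0" and z: "z \<in> D"
  shows "recip_deriv f analytic_on {z}"
proof (cases "is_pole f z")
  case True
  note iso = family_F1_isolated_singularity[OF f(1) z]
  have iso': "isolated_singularity_at (\<lambda>w. inverse (deriv f w)) z"
    by (rule isolated_singularity_at_inverse[OF isolated_singularity_at_deriv[OF iso]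
          is_pole_imp_not_essential[OF is_pole_deriv[OF True iso]]])
  have lim: "(\<lambda>w. inverse (deriv f w)) \<midarrow>z\<rightarrow> 0"
    using is_pole_tendsto[OF is_pole_deriv[OF True iso]] unfolding o_def .
  have "(\<lambda>w. if w = z then 0 else inverse (deriv f w)) analytic_on {z}"
    by (rule removable_singularity'[OF iso' lim])
  also have "?this \<longleftrightarrow> recip_deriv f analytic_on {z}"
  proof (rule analytic_at_cong)
    have "eventually (\<lambda>w. (if w = z then 0 else inverse (deriv f w)) = recip_deriv f w) (at z)"
      using eventually_not_is_pole[OF iso] eventually_neq_at_within[of z z UNIV]
      by eventually_elim (auto simp: recip_deriv_def inverse_eq_divide)
    moreover have "(if z = z then 0 else inverse (deriv f z)) = recip_deriv f z"
      using True by (simp add: recip_deriv_def)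
    ultimately show "eventually (\<lambda>w. (if w = z then 0 else inverse (deriv f w)) = recip_deriv f w) (nhds z)"
      by (simp add: eventually_nhds_conv_at)
  qed simp
  finally show ?thesis .
next
  case False
  note an = family_F1_analytic[OF f(1) z False]
  have "(\<lambda>w. 1 / deriv f w) analytic_on {z}"
    using family_F1_deriv_nonzero[OF f z False]
    by (intro analytic_on_divide analytic_on_const analytic_deriv an) simp
  also have "?this \<longleftrightarrow> recip_deriv f analytic_on {z}"
  proof (rule analytic_at_cong)
    have "eventually (\<lambda>w. 1 / deriv f w = recip_deriv f w) (at z)"
      using eventually_not_is_pole[OF family_F1_isolated_singularity[OF f(1) z]]
      by eventually_elim (auto simp: recip_deriv_def)
    then show "eventually (\<lambda>w. 1 / deriv f w = recip_deriv f w) (nhds z)"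
      using False by (simp add: eventually_nhds_conv_at recip_deriv_def)
  qed simp
  finally show ?thesis .
qed

text \<open>
  The logarithmic derivative has a pole at each pole of \<open>f\<close>, so its reciprocal tends to 0,
  which is the value that the definition assigns there.
\<close>

lemma newton_step_analytic:
  assumes f: "f \<in> family_F1 C D" "C > 0" and z: "z \<in> D"
  shows "newton_step f analytic_on {z}"
proof (cases "is_pole f z")
  case True
  note iso = family_F1_isolated_singularity[OF f(1) z]
  have pole: "is_pole (\<lambda>w. deriv f w / f w) z"
    by (rule is_pole_deriv_divide_is_pole[OF iso True])
  have ness: "not_essential f z"
    using True by (rule is_pole_imp_not_essential)
  have iso': "isolated_singularity_at (\<lambda>w. inverse (deriv f w / f w)) z"
    by (rule isolated_singularity_at_inverse[OF isolated_singularity_at_divide[OF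
          isolated_singularity_at_deriv[OF iso] iso ness] is_pole_imp_not_essential[OF pole]])
  have lim: "(\<lambda>w. inverse (deriv f w / f w)) \<midarrow>z\<rightarrow> 0"
    using is_pole_tendsto[OF pole] unfolding o_def .
  have "(\<lambda>w. if w = z then 0 else inverse (deriv f w / f w)) analytic_on {z}"
    by (rule removable_singularity'[OF iso' lim])
  also have "?this \<longleftrightarrow> newton_step f analytic_on {z}"
  proof (rule analytic_at_cong)
    have "eventually (\<lambda>w. (if w = z then 0 else inverse (deriv f w / f w)) = newton_step f w) (at z)"
      using eventually_not_is_pole[OF iso] eventually_neq_at_within[of z z UNIV]
      by eventually_elim (auto simp: newton_step_def recip_deriv_def)
    moreover have "(if z = z then 0 else inverse (deriv f z / f z)) = newton_step f z"
      using True by (simp add: newton_step_def recip_deriv_def)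
    ultimately show "eventually (\<lambda>w. (if w = z then 0 else inverse (deriv f w / f w)) = newton_step f w) (nhds z)"
      by (simp add: eventually_nhds_conv_at)
  qed simp
  finally show ?thesis .
next
  case False
  show ?thesis
    unfolding newton_step_def[abs_def]
    using family_F1_analytic[OF f(1) z False] recip_deriv_analytic[OF f z]
    by (rule analytic_on_mult)
qed

text \<open>
  Near a simple zero, Newton's method recovers the zero to first order. This makes zeros of
  \<open>f\<close> incompatible with a Newton step that is small on a whole disc.
\<close>

lemma deriv_newton_step_at_zero:
  assumes f: "f \<in> family_F1 C D" "C > 0" and z: "z \<in> D" "\<not> is_pole f z" "f z = 0"
  shows "deriv (newton_step f) z = 1"
proof -
  have "(f has_field_derivative deriv f z) (at z)"
    using family_F1_analytic[OF f(1) z(1,2)] analytic_on_imp_differentiable_at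
      DERIV_deriv_iff_field_differentiable by blast
  moreover have "(recip_deriv f has_field_derivative deriv (recip_deriv f) z) (at z)"
    using recip_deriv_analytic[OF f z(1)] analytic_on_imp_differentiable_at
      DERIV_deriv_iff_field_differentiable by blast
  ultimately have "((\<lambda>w. f w * recip_deriv f w) has_field_derivative
      deriv f z * recip_deriv f z + deriv (recip_deriv f) z * f z) (at z)"
    by (rule DERIV_mult)
  moreover have "deriv f z * recip_deriv f z = 1"
    using family_F1_deriv_nonzero[OF f z(1,2)] z(2) by (simp add: recip_deriv_def)
  moreover have "(\<lambda>w. f w * recip_deriv f w) = newton_step f"
    by (auto simp: newton_step_def)
  ultimately show ?thesis
    using z(3) by (auto intro: DERIV_imp_deriv)
qed


section \<open>Members with small Newton step are large\<close>

lemma analytic_deriv_bound: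
  assumes "f analytic_on cball z r" "r > 0" "\<And>w. w \<in> cball z r \<Longrightarrow> cmod (f w) \<le> B"
  shows "cmod (deriv f z) \<le> B / r"
proof -
  have hol: "f holomorphic_on cball z r"
    using assms(1) by (rule analytic_imp_holomorphic)
  have "cmod ((deriv ^^ 1) f z) \<le> fact 1 * B / r ^ 1"
  proof (rule Cauchy_inequality)
    show "f holomorphic_on ball z r"
      using hol by (rule holomorphic_on_subset) auto
    show "continuous_on (cball z r) f"
      using hol by (rule holomorphic_on_imp_continuous_on)
    show "cmod (f x) \<le> B" if "cmod (z - x) = r" for x
      using assms(3) that by (simp add: dist_norm)
  qed (use assms in auto)
  then show ?thesis
    by simp
qed

text \<open>
  For a nonvanishing \<open>g\<close> the hypothesis says that \<open>f = 1 / g\<close> has a large derivative,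
  \<open>\<epsilon> \<bar>f'\<bar> \<ge> 1\<close>. The proof uses a weighted maximum, as in Landau's approach to Bloch's
  theorem: where \<open>\<bar>g\<bar>\<close> times the distance \<open>d\<close> to the boundary is maximal, \<open>\<bar>g\<bar>\<close> at most
  doubles on the disc of radius \<open>d / 2\<close>, so the Cauchy estimate gives
  \<open>\<bar>g'\<bar> \<le> 4 \<bar>g\<bar> / d\<close>, and the hypothesis turns this into \<open>\<bar>g\<bar> d \<le> 4 \<epsilon>\<close>.
\<close>

lemma bound_of_square_le_deriv:
  assumes an: "g analytic_on cball z r" and "r > 0" "\<epsilon> \<ge> 0"
    and ineq: "\<And>w. w \<in> cball z r \<Longrightarrow> (cmod (g w))\<^sup>2 \<le> \<epsilon> * cmod (deriv g w)"
  shows "cmod (g z) \<le> 4 * \<epsilon> / r"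
proof -
  define h where "h w = cmod (g w) * (r - dist z w)" for w
  have "continuous_on (cball z r) h"
    unfolding h_def using holomorphic_on_imp_continuous_on[OF analytic_imp_holomorphic[OF an]]
    by (intro continuous_intros) auto
  then obtain x where x: "x \<in> cball z r" and max: "\<And>w. w \<in> cball z r \<Longrightarrow> h w \<le> h x"
    using continuous_attains_sup[of "cball z r" h] \<open>r > 0\<close> by auto
  have hz: "cmod (g z) * r \<le> h x"
    using max[of z] \<open>r > 0\<close> by (simp add: h_def)
  define d where "d = r - dist z x"
  have "d \<ge> 0"
    using x by (simp add: d_def)
  have "h x \<le> 4 * \<epsilon>"
  proof (cases "h x = 0")
    case True
    with \<open>\<epsilon> \<ge> 0\<close> show ?thesis by simp
  next
    case False
    then have pos: "d > 0" "cmod (g x) > 0"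
      using \<open>d \<ge> 0\<close> by (auto simp: h_def d_def)
    have sub: "cball x (d / 2) \<subseteq> cball z r"
    proof
      fix w assume "w \<in> cball x (d / 2)"
      then show "w \<in> cball z r"
        using dist_triangle[of z w x] pos by (simp add: d_def)
    qed
    have "cmod (deriv g x) \<le> (2 * cmod (g x)) / (d / 2)"
    proof (rule analytic_deriv_bound)
      fix w assume w: "w \<in> cball x (d / 2)"
      have "d / 2 \<le> r - dist z w"
        using dist_triangle[of z w x] w by (simp add: d_def)
      then have "cmod (g w) * (d / 2) \<le> h w"
        unfolding h_def by (intro mult_left_mono) auto
      also have "\<dots> \<le> cmod (g x) * d"
        using max[of w] w sub by (auto simp: h_def d_def)
      finally show "cmod (g w) \<le> 2 * cmod (g x)"
        using pos by simp
    qed (use pos an sub analytic_on_subset in auto)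
    then have "\<epsilon> * cmod (deriv g x) \<le> \<epsilon> * (4 * cmod (g x) / d)"
      using \<open>\<epsilon> \<ge> 0\<close> by (intro mult_left_mono) auto
    with ineq[OF x] have "cmod (g x) * cmod (g x) \<le> \<epsilon> * (4 * cmod (g x) / d)"
      by (simp add: power2_eq_square)
    then have "cmod (g x) * d \<le> 4 * \<epsilon>"
      using pos by (simp add: field_simps)
    then show ?thesis
      by (simp add: h_def d_def)
  qed
  with hz \<open>r > 0\<close> show ?thesis
    by (simp add: field_simps)
qed

lemma chordal_Fin_Infty_le:
  assumes "w \<noteq> 0"
  shows "chordal (Fin w) Infty \<le> cmod (inverse w)"
proof -
  have "cmod w \<le> sqrt (1 + (cmod w)\<^sup>2)"
    by (rule real_le_rsqrt) simp
  with assms show ?thesis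
    by (simp add: norm_divide inverse_eq_divide frac_le)
qed

lemma chordal_Fin_Fin_le: "chordal (Fin z) (Fin w) \<le> dist z w"
proof -
  have "1 * 1 \<le> sqrt (1 + (cmod z)\<^sup>2) * sqrt (1 + (cmod w)\<^sup>2)"
    by (rule mult_mono) auto
  then show ?thesis
    using divide_left_mono[of 1 "sqrt (1 + (cmod z)\<^sup>2) * sqrt (1 + (cmod w)\<^sup>2)" "cmod (z - w)"]
    by (simp add: dist_norm)
qed

text \<open>
  The Cauchy estimate keeps the derivative of the Newton step below 1, the value that it has at
  every zero.
\<close>

lemma no_zero_if_newton_step_small:
  assumes f: "f \<in> family_F1 C D" "C > 0"
    and "r > 0" "cball z r \<subseteq> D" "B < r"
    and bound: "\<And>w. w \<in> cball z r \<Longrightarrow> cmod (newton_step f w) \<le> B"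
    and "\<not> is_pole f z"
  shows "f z \<noteq> 0"
proof
  assume "f z = 0"
  have "z \<in> D"
    using assms by auto
  then have "deriv (newton_step f) z = 1"
    using deriv_newton_step_at_zero f assms(7) \<open>f z = 0\<close> by blast
  moreover have "cmod (deriv (newton_step f) z) \<le> B / r"
    using assms newton_step_analytic[OF f]
    by (intro analytic_deriv_bound bound) (auto simp: analytic_on_analytic_at[of _ "cball z r"])
  ultimately show False
    using assms by simp
qed

text \<open>
  The convention that \<open>f\<close> takes the value 0 at its poles, together with
  \<open>inverse 0 = 0\<close>, gives the pointwise inverse the correct value at a pole without a case
  distinction.
\<close>

lemma inverse_analytic:
  assumes f: "f \<in> family_F1 C D" and z: "z \<in> D" "is_pole f z \<or> f z \<noteq> 0"
  shows "(\<lambda>w. inverse (f w)) analytic_on {z}"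
proof (cases "is_pole f z")
  case True
  have "isolated_singularity_at (\<lambda>w. inverse (f w)) z"
    by (rule isolated_singularity_at_inverse[OF family_F1_isolated_singularity[OF f z(1)]
          is_pole_imp_not_essential[OF True]])
  then have "(\<lambda>w. if w = z then 0 else inverse (f w)) analytic_on {z}"
    using is_pole_tendsto[OF True] unfolding o_def by (rule removable_singularity')
  also have "(\<lambda>w. if w = z then 0 else inverse (f w)) = (\<lambda>w. inverse (f w))"
    using family_F1_value_at_pole[OF f z(1) True] by auto
  finally show ?thesis .
next
  case False
  then show ?thesis
    using z family_F1_analytic[OF f z(1)] by (intro analytic_on_inverse) auto
qed

text \<open>
  On the disc of radius \<open>r\<close> the function has no zeros, because each point of it is the centre of
  a disc of radius \<open>r\<close> on which the Newton step is small. There \<open>1 / f\<close> is holomorphic and its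
  squared modulus is the modulus of its derivative times that of the reciprocal derivative of
  \<open>f\<close>.
\<close>

lemma large_if_newton_step_small:
  assumes f: "f \<in> family_F1 C D" "C > 0"
    and r: "r > 0" "cball z (2 * r) \<subseteq> D"
    and newton: "\<And>w. w \<in> cball z (2 * r) \<Longrightarrow> cmod (newton_step f w) \<le> r / 2"
    and recip: "\<And>w. w \<in> cball z (2 * r) \<Longrightarrow> cmod (recip_deriv f w) \<le> \<epsilon>"
  shows "chordal (sphere_val f z) Infty \<le> 4 * \<epsilon> / r"
proof -
  have sub: "cball w r \<subseteq> cball z (2 * r)" if "w \<in> cball z r" for w
  proof
    fix x assume "x \<in> cball w r"
    then show "x \<in> cball z (2 * r)"
      using that dist_triangle[of z x w] by simp
  qed
  have D: "w \<in> D" and nz: "is_pole f w \<or> f w \<noteq> 0" if "w \<in> cball z r" for w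
  proof -
    show "w \<in> D"
      using sub[OF that] r centre_in_cball[of w r] by (meson less_imp_le subsetD)
    show "is_pole f w \<or> f w \<noteq> 0"
    proof (cases "is_pole f w")
      case False
      then have "f w \<noteq> 0"
        using sub[OF that] r newton
        by (intro no_zero_if_newton_step_small[OF f r(1), where B = "r / 2"]) auto
      then show ?thesis ..
    qed simp
  qed
  have "cmod (inverse (f z)) \<le> 4 * \<epsilon> / r"
  proof (rule bound_of_square_le_deriv[where g = "\<lambda>w. inverse (f w)", OF _ r(1)])
    show "\<epsilon> \<ge> 0"
      using recip[of z] r(1) norm_ge_zero[of "recip_deriv f z"] by (simp del: norm_ge_zero)
    show "(\<lambda>w. inverse (f w)) analytic_on cball z r"
      using inverse_analytic[OF f(1) D nz] by (subst analytic_on_analytic_at) auto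
    fix w assume w: "w \<in> cball z r"
    have le: "cmod (recip_deriv f w) \<le> \<epsilon>"
      using recip w r by auto
    show "(cmod (inverse (f w)))\<^sup>2 \<le> \<epsilon> * cmod (deriv (\<lambda>w. inverse (f w)) w)"
    proof (cases "is_pole f w")
      case True
      then show ?thesis
        using family_F1_value_at_pole[OF f(1) D[OF w]] order_trans[OF norm_ge_zero le] by simp
    next
      case False
      then have nz': "f w \<noteq> 0" and d: "deriv f w \<noteq> 0"
        using nz[OF w] family_F1_deriv_nonzero[OF f D[OF w]] by auto
      have "(f has_field_derivative deriv f w) (at w)"
        using family_F1_analytic[OF f(1) D[OF w] False] analytic_on_imp_differentiable_at
          DERIV_deriv_iff_field_differentiable by blast
      then have "deriv (\<lambda>w. inverse (f w)) w = - (inverse (f w) * deriv f w * inverse (f w))"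
        using nz' by (intro DERIV_imp_deriv DERIV_inverse')
      then have "(cmod (inverse (f w)))\<^sup>2
          = cmod (recip_deriv f w) * cmod (deriv (\<lambda>w. inverse (f w)) w)"
        using False d by (simp add: recip_deriv_def norm_mult norm_divide power2_eq_square field_simps)
      also have "\<dots> \<le> \<epsilon> * cmod (deriv (\<lambda>w. inverse (f w)) w)"
        using le by (intro mult_right_mono) auto
      finally show ?thesis .
    qed
  qed
  moreover have "chordal (sphere_val f z) Infty \<le> cmod (inverse (f z))"
    using chordal_Fin_Infty_le[of "f z"] nz[of z] r(1) by (auto simp: sphere_val_def simp del: chordal.simps(2))
  ultimately show ?thesis
    by linarith
qed


section \<open>Quasi-normality on every domain\<close>

lemma compact_nonvanishing_lower_bound:
  fixes u :: "complex \<Rightarrow> complex"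
  assumes "compact K" "continuous_on K u" "\<And>z. z \<in> K \<Longrightarrow> u z \<noteq> 0"
  obtains b where "b > 0" "\<And>z. z \<in> K \<Longrightarrow> b \<le> cmod (u z)"
proof (cases "K = {}")
  case True
  then show thesis
    using that[of 1] by simp
next
  case False
  have "continuous_on K (\<lambda>z. cmod (u z))"
    using assms(2) by (intro continuous_intros)
  then obtain x where "x \<in> K" "\<And>z. z \<in> K \<Longrightarrow> cmod (u x) \<le> cmod (u z)"
    using continuous_attains_inf[of K "\<lambda>z. cmod (u z)"] assms(1) False by blast
  then show thesis
    using that[of "cmod (u x)"] assms(3) by simp
qed

lemma uniform_quotient:
  fixes a b :: "nat \<Rightarrow> complex \<Rightarrow> complex"
  assumes "compact K" "uniform_limit K a l sequentially" "uniform_limit K b m sequentially"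
    "continuous_on K l" "continuous_on K m" "0 \<notin> m ` K"
  shows "uniform_limit K (\<lambda>n z. a n z / b n z) (\<lambda>z. l z / m z) sequentially"
    and "eventually (\<lambda>n. \<forall>z\<in>K. b n z \<noteq> 0) sequentially"
proof -
  obtain \<beta> where \<beta>: "\<beta> > 0" "\<And>z. z \<in> K \<Longrightarrow> \<beta> \<le> cmod (m z)"
    using compact_nonvanishing_lower_bound[of K m] assms by (metis image_eqI)
  have "bounded (l ` K)"
    using assms by (intro compact_imp_bounded compact_continuous_image)
  then show "uniform_limit K (\<lambda>n z. a n z / b n z) (\<lambda>z. l z / m z) sequentially"
    using assms \<beta> by (intro uniform_lim_divide)
  have "eventually (\<lambda>n. \<forall>z\<in>K. dist (b n z) (m z) < \<beta>) sequentially"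
    using assms(3) \<beta>(1) by (rule uniform_limitD)
  then show "eventually (\<lambda>n. \<forall>z\<in>K. b n z \<noteq> 0) sequentially"
    by (rule eventually_mono) (use \<beta> in \<open>fastforce simp: dist_norm\<close>)
qed

lemma uniform_limit_chordalI:
  fixes a :: "nat \<Rightarrow> complex \<Rightarrow> complex"
  assumes "uniform_limit K a l sequentially"
    and "eventually (\<lambda>n. \<forall>z\<in>K. chordal (s n z) (g z) \<le> dist (a n z) (l z)) sequentially"
  shows "uniform_limit K s g sequentially"
  unfolding uniform_limit_iff
proof (intro allI impI)
  fix e :: real assume "e > 0"
  from uniform_limitD[OF assms(1) this] assms(2)
  show "eventually (\<lambda>n. \<forall>z\<in>K. dist (s n z) (g z) < e) sequentially"
    by eventually_elim (force simp: dist_riemann_sphere_def)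
qed

lemma zeros_discrete:
  assumes "open D" "connected D" "u holomorphic_on D" "\<exists>z\<in>D. u z \<noteq> 0"
  shows "\<forall>z\<in>D. \<not> z islimpt {z\<in>D. u z = 0}"
  using analytic_continuation[OF assms(3,1,2), of "{z\<in>D. u z = 0}"] assms(4) by blast

lemma uniformly_bounded_Montel:
  fixes h :: "nat \<Rightarrow> complex \<Rightarrow> complex"
  assumes "open D" "\<And>n. h n holomorphic_on D" "\<And>n z. z \<in> D \<Longrightarrow> cmod (h n z) \<le> B"
  obtains g r where "g holomorphic_on D" "strict_mono (r :: nat \<Rightarrow> nat)"
    "\<And>K. compact K \<Longrightarrow> K \<subseteq> D \<Longrightarrow> uniform_limit K (\<lambda>n. h (r n)) g sequentially"
proof (rule Montel[of D "range h" h])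
  show "open D"
    by (rule assms(1))
  show "k holomorphic_on D" if "k \<in> range h" for k
    using that assms(2) by auto
  show "\<exists>B. \<forall>k\<in>range h. \<forall>z\<in>K. cmod (k z) \<le> B" if "compact K" "K \<subseteq> D" for K
    using that(2) assms(3) by (intro exI[of _ B]) auto
  show "range h \<subseteq> range h"
    by simp
next
  fix g r
  assume g: "g holomorphic_on D" "strict_mono (r :: nat \<Rightarrow> nat)"
    and lim: "\<And>K. compact K \<Longrightarrow> K \<subseteq> D \<Longrightarrow> uniform_limit K (h \<circ> r) g sequentially"
  show thesis
    by (rule that[OF g]) (use lim in \<open>simp add: o_def\<close>)
qed

text \<open>
  A common subsequence for the reciprocal derivatives and the Newton steps determines the limit
  of the functions themselves, as their quotient. The exceptional set is formed by the zeros of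
  the first limit that does not vanish identically, and is empty if both limits vanish.
\<close>

lemma quasi_normal_family_F1:
  assumes D: "open D" "connected D" and C: "C > 0"
  shows "quasi_normal (family_F1 C D) D"
  unfolding quasi_normal_def
proof (intro allI impI)
  fix f :: "nat \<Rightarrow> complex \<Rightarrow> complex"
  assume "range f \<subseteq> family_F1 C D"
  then have F: "f n \<in> family_F1 C D" for n
    by auto
  have hol: "recip_deriv (f n) holomorphic_on D" "newton_step (f n) holomorphic_on D" for n
    using recip_deriv_analytic[OF F C] newton_step_analytic[OF F C]
    by (intro analytic_imp_holomorphic; subst analytic_on_analytic_at; blast)+
  obtain u r1 where u: "u holomorphic_on D" "strict_mono (r1 :: nat \<Rightarrow> nat)"
    and ulim: "\<And>K. compact K \<Longrightarrow> K \<subseteq> D \<Longrightarrow>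
      uniform_limit K (\<lambda>n. recip_deriv (f (r1 n))) u sequentially"
    by (rule uniformly_bounded_Montel[where h = "\<lambda>n. recip_deriv (f n)",
        OF D(1) hol(1) norm_recip_deriv_le[OF F C]])
      (assumption, rule that, simp_all)
  obtain v r2 where v: "v holomorphic_on D" "strict_mono (r2 :: nat \<Rightarrow> nat)"
    and vlim: "\<And>K. compact K \<Longrightarrow> K \<subseteq> D \<Longrightarrow>
      uniform_limit K (\<lambda>n. newton_step (f (r1 (r2 n)))) v sequentially"
    by (rule uniformly_bounded_Montel[where h = "\<lambda>n. newton_step (f (r1 n))",
        OF D(1) hol(2) norm_newton_step_le[OF F C]])
      (assumption, rule that, simp_all)
  define r where "r = r1 \<circ> r2"
  have r: "strict_mono r"
    using u(2) v(2) by (simp add: r_def strict_mono_o)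
  define U V where "U n = recip_deriv (f (r n))" and "V n = newton_step (f (r n))" for n
  have Ulim: "uniform_limit K U u sequentially" if "compact K" "K \<subseteq> D" for K
    using filterlim_compose[OF ulim[OF that] filterlim_subseq[OF v(2)]]
    by (simp add: U_def[abs_def] r_def)
  have Vlim: "uniform_limit K V v sequentially" if "compact K" "K \<subseteq> D" for K
    using vlim[OF that] by (simp add: V_def[abs_def] r_def o_def)
  have contu: "continuous_on K u" "continuous_on K v" if "K \<subseteq> D" for K
    using that u(1) v(1) holomorphic_on_imp_continuous_on holomorphic_on_subset by blast+
  have "\<exists>E\<subseteq>D. (\<forall>z\<in>D. \<not> z islimpt E) \<and> chordal_convergent_on (f \<circ> r) (D - E)"
  proof -
    consider (finite) "\<exists>z\<in>D. u z \<noteq> 0" | (infinite) "\<forall>z\<in>D. u z = 0" "\<exists>z\<in>D. v z \<noteq> 0"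
      | (vanishing) "\<forall>z\<in>D. u z = 0" "\<forall>z\<in>D. v z = 0"
      by blast
    then show ?thesis
    proof cases
      case finite
      define E where "E = {z\<in>D. u z = 0}"
      have "uniform_limit K (\<lambda>n. sphere_val (f (r n))) (\<lambda>z. Fin (v z / u z)) sequentially"
        if K: "compact K" "K \<subseteq> D - E" for K
      proof (rule uniform_limit_chordalI)
        have KD: "K \<subseteq> D" and nz: "0 \<notin> u ` K"
          using K(2) by (auto simp: E_def)
        note q = uniform_quotient[OF K(1) Vlim[OF K(1) KD] Ulim[OF K(1) KD] contu(2,1)[OF KD] nz]
        show "uniform_limit K (\<lambda>n z. V n z / U n z) (\<lambda>z. v z / u z) sequentially"
          by (rule q(1))
        from q(2) show "eventually (\<lambda>n. \<forall>z\<in>K. chordal (sphere_val (f (r n)) z) (Fin (v z / u z))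
            \<le> dist (V n z / U n z) (v z / u z)) sequentially"
        proof eventually_elim
          case (elim n)
          show ?case
          proof
            fix z assume z: "z \<in> K"
            then have "\<not> is_pole (f (r n)) z"
              using elim by (auto simp: U_def recip_deriv_def)
            moreover have "f (r n) z = V n z / U n z"
              using elim z by (simp add: U_def V_def newton_step_def)
            ultimately show "chordal (sphere_val (f (r n)) z) (Fin (v z / u z))
                \<le> dist (V n z / U n z) (v z / u z)"
              using chordal_Fin_Fin_le by (simp add: sphere_val_def del: chordal.simps)
          qed
        qed
      qed
      then have "chordal_convergent_on (f \<circ> r) (D - E)"
        unfolding chordal_convergent_on_def by (intro exI[of _ "\<lambda>z. Fin (v z / u z)"]) simp
      then show ?thesis
        using zeros_discrete[OF D u(1) finite] by (intro exI[of _ E]) (auto simp: E_def)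
    next
      case infinite
      define E where "E = {z\<in>D. v z = 0}"
      have "uniform_limit K (\<lambda>n. sphere_val (f (r n))) (\<lambda>z. Infty) sequentially"
        if K: "compact K" "K \<subseteq> D - E" for K
      proof (rule uniform_limit_chordalI)
        have KD: "K \<subseteq> D" and nz: "0 \<notin> v ` K"
          using K(2) by (auto simp: E_def)
        note q = uniform_quotient[OF K(1) Ulim[OF K(1) KD] Vlim[OF K(1) KD] contu[OF KD] nz]
        show "uniform_limit K (\<lambda>n z. U n z / V n z) (\<lambda>z. u z / v z) sequentially"
          by (rule q(1))
        from q(2) show "eventually (\<lambda>n. \<forall>z\<in>K. chordal (sphere_val (f (r n)) z) Infty
            \<le> dist (U n z / V n z) (u z / v z)) sequentially"
        proof eventually_elim
          case (elim n)
          show ?case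
          proof
            fix z assume z: "z \<in> K"
            then have "V n z \<noteq> 0"
              using elim by blast
            then have np: "\<not> is_pole (f (r n)) z" and nz: "f (r n) z \<noteq> 0" "U n z \<noteq> 0"
              by (auto simp: V_def U_def newton_step_def recip_deriv_def)
            have "inverse (f (r n) z) = U n z / V n z"
              using nz by (simp add: U_def V_def newton_step_def field_simps)
            moreover have "dist (U n z / V n z) (u z / v z) = cmod (U n z / V n z)"
              using infinite(1) z KD by (auto simp: dist_norm)
            ultimately show "chordal (sphere_val (f (r n)) z) Infty
                \<le> dist (U n z / V n z) (u z / v z)"
              using np chordal_Fin_Infty_le[OF nz(1)]
              by (simp add: sphere_val_def del: chordal.simps)
          qed
        qed
      qed
      then have "chordal_convergent_on (f \<circ> r) (D - E)"
        unfolding chordal_convergent_on_def by (intro exI[of _ "\<lambda>z. Infty"]) simp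
      then show ?thesis
        using zeros_discrete[OF D v(1) infinite(2)] by (intro exI[of _ E]) (auto simp: E_def)
    next
      case vanishing
      have "uniform_limit K (\<lambda>n. sphere_val (f (r n))) (\<lambda>z. Infty) sequentially"
        if K: "compact K" "K \<subseteq> D" for K
        unfolding uniform_limit_iff
      proof (intro allI impI)
        fix e :: real assume e: "e > 0"
        obtain \<rho> where \<rho>: "\<rho> > 0" "(\<Union>z\<in>K. cball z \<rho>) \<subseteq> D"
          using compact_subset_open_imp_cball_epsilon_subset[OF K(1) D(1) K(2)] by blast
        define K' where "K' = (\<Union>z\<in>K. cball z \<rho>)"
        have K': "compact K'" "K' \<subseteq> D"
          using \<rho> compact_minkowski_sum_cball[OF K(1)] by (auto simp: K'_def)
        have "eventually (\<lambda>n. \<forall>z\<in>K'. dist (V n z) (v z) < \<rho> / 4) sequentially"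
          using \<rho>(1) by (intro uniform_limitD[OF Vlim[OF K']]) auto
        moreover have "eventually (\<lambda>n. \<forall>z\<in>K'. dist (U n z) (u z) < e * \<rho> / 16) sequentially"
          using \<rho>(1) e by (intro uniform_limitD[OF Ulim[OF K']]) auto
        ultimately show "eventually (\<lambda>n. \<forall>z\<in>K. dist (sphere_val (f (r n)) z) Infty < e) sequentially"
        proof eventually_elim
          case (elim n)
          show ?case
          proof
            fix z assume z: "z \<in> K"
            have small: "cmod (V n w) \<le> \<rho> / 2 / 2" "cmod (U n w) \<le> e * \<rho> / 16"
              if "w \<in> cball z (2 * (\<rho> / 2))" for w
            proof -
              have "w \<in> K'"
                using that z by (auto simp: K'_def)
              then show "cmod (V n w) \<le> \<rho> / 2 / 2" "cmod (U n w) \<le> e * \<rho> / 16"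
                using elim vanishing K'(2) by (force simp: dist_norm)+
            qed
            have "chordal (sphere_val (f (r n)) z) Infty \<le> 4 * (e * \<rho> / 16) / (\<rho> / 2)"
              using \<rho> z small unfolding U_def V_def
              by (intro large_if_newton_step_small[OF F C]) auto
            also have "\<dots> < e"
              using \<rho>(1) e by simp
            finally show "dist (sphere_val (f (r n)) z) Infty < e"
              by (simp add: dist_riemann_sphere_def)
          qed
        qed
      qed
      then have "chordal_convergent_on (f \<circ> r) (D - {})"
        unfolding chordal_convergent_on_def by (intro exI[of _ "\<lambda>z. Infty"]) simp
      then show ?thesis
        by (intro exI[of _ "{}"]) auto
    qed
  qed
  with r show "\<exists>r E. strict_mono (r :: nat \<Rightarrow> nat) \<and> E \<subseteq> D \<and> (\<forall>z\<in>D. \<not> z islimpt E) \<and>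
      chordal_convergent_on (f \<circ> r) (D - E)"
    by blast
qed


section \<open>A sequence with infinitely many irregular points\<close>

definition exp_seq :: "nat \<Rightarrow> complex \<Rightarrow> complex" where
  "exp_seq n z = of_nat (n + 1) * (exp z - 1)"

lemma exp_seq_analytic: "exp_seq n analytic_on A"
  unfolding exp_seq_def[abs_def] by (intro analytic_intros)

lemma exp_seq_no_pole: "\<not> is_pole (exp_seq n) z"
  using exp_seq_analytic by (rule analytic_at_imp_no_pole)

lemma deriv_exp_seq: "deriv (exp_seq n) z = of_nat (n + 1) * exp z"
  unfolding exp_seq_def[abs_def] by (rule DERIV_imp_deriv) (auto intro!: derivative_eq_intros)

text \<open>
  On the half-plane \<open>\<bar>exp z\<bar> > 1 / e > 1 / 3\<close>, hence \<open>\<bar>exp z\<bar> + 2 < 7 \<bar>exp z\<bar>\<close>; this is the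
  room that the constant \<open>1 / 8\<close> needs.
\<close>

lemma exp_seq_in_family: "exp_seq n \<in> family_F1 (1 / 8) {z. Re z > -1}"
proof -
  have "1 / 8 < cmod (deriv (exp_seq n) z) / (1 + cmod (exp_seq n z))" if "Re z > -1" for z
  proof -
    define x where "x = exp (Re z)"
    have "1 / 3 \<le> exp (- 1 :: real)"
      using exp_le by (simp add: exp_minus field_simps)
    also have "\<dots> < x"
      using that by (simp add: x_def)
    finally have x: "1 < 3 * x"
      by simp
    have "cmod (exp z - 1) \<le> x + 1"
      using norm_triangle_ineq4[of "exp z" 1] by (simp add: x_def)
    then have "real (n + 1) * cmod (exp z - 1) \<le> real (n + 1) * (x + 1)"
      by (intro mult_left_mono) auto
    then have "1 + real (n + 1) * cmod (exp z - 1) \<le> real (n + 1) * (x + 2)"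
      by (simp add: algebra_simps)
    also have "\<dots> < real (n + 1) * (8 * x)"
      using x by (intro mult_strict_left_mono) auto
    finally have "1 + cmod (exp_seq n z) < 8 * cmod (deriv (exp_seq n) z)"
      by (simp add: exp_seq_def deriv_exp_seq norm_mult x_def del: of_nat_add of_nat_Suc)
    moreover have "0 < 1 + cmod (exp_seq n z)"
      by (simp add: add_pos_nonneg)
    ultimately show ?thesis
      by (simp add: pos_less_divide_eq)
  qed
  then show ?thesis
    using exp_seq_no_pole analytic_on_imp_nicely_meromorphic_on[OF exp_seq_analytic]
    by (auto simp: family_F1_def deriv_quotient_def ennreal_less_iff)
qed

lemma exp_seq_tendsto_Infty:
  assumes "exp z \<noteq> 1" "strict_mono (r :: nat \<Rightarrow> nat)"
  shows "(\<lambda>n. sphere_val (exp_seq (r n)) z) \<longlonglongrightarrow> Infty"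
proof -
  have "(\<lambda>n. inverse (real (n + 1)) * cmod (inverse (exp z - 1))) \<longlonglongrightarrow> 0 * cmod (inverse (exp z - 1))"
    using LIMSEQ_inverse_real_of_nat by (intro tendsto_mult) auto
  from filterlim_compose[OF this filterlim_subseq[OF assms(2)]]
  have lim: "(\<lambda>n. cmod (inverse (exp_seq (r n) z))) \<longlonglongrightarrow> 0"
    by (simp add: exp_seq_def norm_mult norm_inverse del: of_nat_add of_nat_Suc)
  have "dist (sphere_val (exp_seq (r n)) z) Infty \<le> cmod (inverse (exp_seq (r n) z))" for n
  proof -
    have "exp_seq (r n) z \<noteq> 0"
      using assms(1) by (simp add: exp_seq_def del: of_nat_add of_nat_Suc)
    from chordal_Fin_Infty_le[OF this] show ?thesis
      using exp_seq_no_pole by (simp add: dist_riemann_sphere_def sphere_val_def del: chordal.simps)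
  qed
  then have "(\<lambda>n. dist (sphere_val (exp_seq (r n)) z) Infty) \<longlonglongrightarrow> 0"
    by (intro tendsto_sandwich[OF _ _ tendsto_const lim]) auto
  then show ?thesis
    by (subst tendsto_dist_iff)
qed

text \<open>
  A limit would have to be infinite at all points near \<open>p\<close> other than \<open>p\<close>, but the \<open>n\<close>-th
  function takes the value 1 at points that approach \<open>p\<close>.
\<close>

lemma exp_seq_not_convergent:
  assumes r: "strict_mono (r :: nat \<Rightarrow> nat)" and p: "exp p = 1" "p \<in> U" "open U"
  shows "\<not> chordal_convergent_on (exp_seq \<circ> r) U"
proof
  assume "chordal_convergent_on (exp_seq \<circ> r) U"
  then obtain g where g: "\<And>K. compact K \<Longrightarrow> K \<subseteq> U \<Longrightarrow>
      uniform_limit K (\<lambda>n. sphere_val (exp_seq (r n))) g sequentially"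
    by (auto simp: chordal_convergent_on_def)
  obtain e where e: "e > 0" "cball p e \<subseteq> U"
    using p open_contains_cball by blast
  have gInf: "g z = Infty" if "z \<in> cball p e" "exp z \<noteq> 1" for z
    by (rule LIMSEQ_unique[OF tendsto_uniform_limitI[OF g[OF compact_cball e(2)] that(1)]
          exp_seq_tendsto_Infty[OF that(2) r]])
  \<comment> \<open>the solution of \<open>exp_seq (r n) x = 1\<close> near \<open>p\<close>\<close>
  define x where "x n = p + of_real (ln (1 + inverse (real (r n + 1))))" for n
  have expx: "exp (x n) = 1 + inverse (of_nat (r n + 1))" for n
  proof -
    have "exp (x n) = of_real (exp (ln (1 + inverse (real (r n + 1)))))"
      unfolding x_def exp_add p(1) by (simp only: mult_1 exp_of_real)
    also have "exp (ln (1 + inverse (real (r n + 1)))) = 1 + inverse (real (r n + 1))"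
      by (subst exp_ln) (auto intro: add_pos_nonneg)
    finally show ?thesis
      by simp
  qed
  have "(\<lambda>n. p + of_real (ln (1 + inverse (real (n + 1))))) \<longlonglongrightarrow> p + of_real (ln (1 + 0))"
    using LIMSEQ_inverse_real_of_nat by (intro tendsto_intros) auto
  from filterlim_compose[OF this filterlim_subseq[OF r]] have "x \<longlonglongrightarrow> p"
    by (simp add: x_def[abs_def])
  then have "eventually (\<lambda>n. dist (x n) p < e) sequentially"
    using e(1) by (rule tendstoD)
  moreover have "eventually (\<lambda>n. \<forall>z\<in>cball p e. dist (sphere_val (exp_seq (r n)) z) (g z) < 1 / 2)
      sequentially"
    by (rule uniform_limitD[OF g[OF compact_cball e(2)]]) simp
  ultimately have "eventually (\<lambda>n. False) sequentially"
  proof eventually_elim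
    case (elim n)
    have xn: "x n \<in> cball p e"
      using elim(1) by (simp add: dist_commute)
    have "exp (x n) \<noteq> 1"
      unfolding expx by (simp del: of_nat_add of_nat_Suc)
    then have "g (x n) = Infty"
      using gInf xn by blast
    moreover have "sphere_val (exp_seq (r n)) (x n) = Fin 1"
      using exp_seq_no_pole by (simp add: sphere_val_def exp_seq_def expx del: of_nat_add of_nat_Suc)
    moreover have "dist (sphere_val (exp_seq (r n)) (x n)) (g (x n)) < 1 / 2"
      using elim(2) xn by blast
    ultimately have "1 / sqrt 2 < 1 / (2 :: real)"
      by (simp add: dist_riemann_sphere_def)
    moreover have "sqrt 2 < 2"
      using real_less_lsqrt[of 2 2] by simp
    ultimately show False
      by (simp add: field_simps)
  qed
  then show False
    by simp
qed

lemma family_F1_not_finite_order: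
  "\<not> quasi_normal_order_le \<nu> (family_F1 (1 / 8) {z. Re z > -1}) {z. Re z > -1}"
proof
  let ?D = "{z. Re z > -1}"
  assume "quasi_normal_order_le \<nu> (family_F1 (1 / 8) ?D) ?D"
  moreover have "range exp_seq \<subseteq> family_F1 (1 / 8) ?D"
    using exp_seq_in_family by auto
  ultimately obtain r E where r: "strict_mono (r :: nat \<Rightarrow> nat)" and "finite E"
    and conv: "chordal_convergent_on (exp_seq \<circ> r) (?D - E)"
    unfolding quasi_normal_order_le_def by blast
  define p :: "nat \<Rightarrow> complex" where "p k = of_real (2 * real k * pi) * \<i>" for k
  have "inj p"
    unfolding inj_def p_def by simp
  then have "infinite (range p)"
    by (rule range_inj_infinite)
  then obtain k where k: "p k \<notin> E"
    using \<open>finite E\<close> by (meson finite_subset image_subsetI)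
  have op: "open (?D - E)"
    using \<open>finite E\<close> by (intro open_Diff finite_imp_closed open_halfspace_Re_gt)
  have pk: "p k \<in> ?D - E"
    using k by (simp add: p_def)
  have "exp (p k) = 1"
    unfolding exp_eq_1 p_def by (intro conjI exI[of _ "int k"]) simp_all
  from exp_seq_not_convergent[OF r this pk op] conv show False ..
qed

theorem mainTheorem2:
  "\<exists>(D :: complex set) (C :: real).
     complex_domain D \<and> C > 0 \<and> quasi_normal_infinite_order (family_F1 C D) D"
proof (intro exI conjI)
  let ?D = "{z. Re z > -1}"
  have D: "open ?D" "connected ?D"
    by (auto intro: open_halfspace_Re_gt convex_connected convex_halfspace_Re_gt)
  moreover have "0 \<in> ?D"
    by simp
  ultimately show "complex_domain ?D"
    unfolding complex_domain_def by blast
  show "(1 / 8 :: real) > 0"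
    by simp
  show "quasi_normal_infinite_order (family_F1 (1 / 8) ?D) ?D"
    unfolding quasi_normal_infinite_order_def
    using quasi_normal_family_F1[OF D, of "1 / 8"] family_F1_not_finite_order by simp
qed

end
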